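(* Let $I=(0,1)$, and for $d\ge 1$ equip the cube $I^d$ with Lebesgue measure $dx$ and the Euclidean distance. (1) For every Bessel sequence $(u_k)_{k\ge 1}$ in $L^2_0(I,dx)$, $$\sum_k \|u_k\|_{KR}^2<\infty .$$ (2) Let $d\in\{2,3,\dots\}$. For every Bessel sequence $(u_k)_{k\ge1}$ in $L^2_0(I^d,dx)$, $$\sum_k \|u_k\|_{KR}^{d+\epsilon}<\infty\quad\text{for all }\epsilon>0 .$$ (3) Let $d\ge 1$. For the orthonormal sequence $(u_n)_{n\in(2\mathbb N)^d}$ in $L^2(I^d,dx)$ given by $$u_n(x)=2^{d/2}\sin(\pi n_1x_1)\sin(\pi n_2x_2)\cdots\sin(\pi n_dx_d),\qquad n=(n_1,\dots,n_d)\in(2\mathbb N)^d,$$ one has $$\sum_{n\in(2\mathbb N)^d}\|u_n\|_{KR}^d=\infty .$$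
   Context: All functions are real valued. $\mathbb N=\{1,2,3,\dots\}$, so $2\mathbb N$ is the set of positive even integers. $L^2_0(I^d,dx)=\{f\in L^2_{\mathbb R}(I^d,dx):\int_{I^d} f\,dx=0\}$, with inner product $(f,g)=\int fg\,dx$. A sequence $(u_k)$ in $L^2_0$ is a Bessel sequence if there is $B<\infty$ such that $\sum_k|(f,u_k)|^2\le B^2\|f\|_2^2$ for all $f\in L^2_0$. For $u\in L^2_0(I^d,dx)$ the Kantorovich--Rubinstein norm is $$\|u\|_{KR}=\sup\Big\{\int_{I^d}uf\,dx:\ f:I^d\to\mathbb R,\ |f(x)-f(y)|\le|x-y|\ \text{for all }x,y\in I^d\Big\},$$ where $|\cdot|$ is the Euclidean norm (equivalently, the optimal cost, for the cost function $|x-y|$, of transporting the measure $u^+dx$ to $u^-dx$, $u^\pm=\max(0,\pm u)$). *)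

theory Defs
  imports "HOL-Analysis.Analysis"
begin

definition unit_cube :: "'a::euclidean_space set" where
  "unit_cube = box 0 One"

lemma unit_cube_real: "(unit_cube :: real set) = {0<..<1}"
  by (auto simp: unit_cube_def)

lemma unit_cube_vec: "(unit_cube :: (real^'n) set) = {x. \<forall>i. 0 < x $ i \<and> x $ i < 1}"
  by (auto simp: unit_cube_def mem_box_cart cart_eq_inner_axis inner_sum_left_Basis axis_inverse)

(* Elements of L2 are represented by functions; only their values on the cube matter, and all
   notions below are invariant under changes on a null set. *)
definition L2_cube :: "('a::euclidean_space \<Rightarrow> real) set" where
  "L2_cube = {u. u \<in> borel_measurable (lebesgue_on unit_cube) \<and>
                 integrable (lebesgue_on unit_cube) (\<lambda>x. (u x)\<^sup>2)}"

definition L2_inner :: "('a::euclidean_space \<Rightarrow> real) \<Rightarrow> ('a \<Rightarrow> real) \<Rightarrow> real" where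
  "L2_inner f g = (LINT x|lebesgue_on unit_cube. f x * g x)"

definition L2_norm_cube :: "('a::euclidean_space \<Rightarrow> real) \<Rightarrow> real" where
  "L2_norm_cube f = sqrt (L2_inner f f)"

definition L2_0 :: "('a::euclidean_space \<Rightarrow> real) set" where
  "L2_0 = {u \<in> L2_cube. (LINT x|lebesgue_on unit_cube. u x) = 0}"

definition bessel_sequence :: "(nat \<Rightarrow> 'a::euclidean_space \<Rightarrow> real) \<Rightarrow> bool" where
  "bessel_sequence u \<longleftrightarrow> (\<forall>k. u k \<in> L2_0) \<and>
     (\<exists>B. \<forall>f\<in>L2_0. summable (\<lambda>k. \<bar>L2_inner f (u k)\<bar>\<^sup>2) \<and>
        (\<Sum>k. \<bar>L2_inner f (u k)\<bar>\<^sup>2) \<le> B\<^sup>2 * (L2_norm_cube f)\<^sup>2)"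

definition orthonormal_family :: "'i set \<Rightarrow> ('i \<Rightarrow> 'a::euclidean_space \<Rightarrow> real) \<Rightarrow> bool" where
  "orthonormal_family N u \<longleftrightarrow> (\<forall>n\<in>N. u n \<in> L2_cube) \<and>
     (\<forall>m\<in>N. \<forall>n\<in>N. L2_inner (u m) (u n) = (if m = n then 1 else 0))"

(* Intended for u in L2_0. There the zero mean of u makes the set bounded above (f may be
   shifted to vanish at a point, after which it is bounded by the diameter of the cube), so that
   this is a genuine supremum; without zero mean the set would be unbounded. *)
definition KR_norm :: "('a::euclidean_space \<Rightarrow> real) \<Rightarrow> real" where
  "KR_norm u = Sup {LINT x|lebesgue_on unit_cube. u x * f x | f. 1-lipschitz_on unit_cube f}"

definition even_indices :: "(nat^'n) set" where
  "even_indices = {n. \<forall>i. 0 < n $ i \<and> even (n $ i)}"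

definition sine_product :: "nat^'n \<Rightarrow> real^'n \<Rightarrow> real" where
  "sine_product n x = 2 powr (real CARD('n) / 2) * (\<Prod>i\<in>UNIV. sin (pi * real (n $ i) * x $ i))"

end

theory Submission
  imports Defs
begin

text \<open>
  Both positive statements are instances of one estimate: in dimension \<open>d\<close>, the powers
  \<open>\<parallel>u k\<parallel>\<^sub>K\<^sub>R powr p\<close> of a Bessel sequence are summable whenever \<open>2 \<le> p\<close> and \<open>d < p\<close>
  (\<open>bessel_KR_summable\<close>).

  Mass can be transported scale by scale. Replacing a Lipschitz test function by its values at the
  centres of the dyadic cells of side \<open>2^-j\<close> and telescoping over \<open>j\<close> gives
  \<open>\<parallel>u\<parallel>\<^sub>K\<^sub>R \<le> d * (\<Sum>j. 2^-j * V (j + 1))\<close>, where \<open>V j\<close> is the sum over the cells \<open>Q\<close> of scale \<open>j\<close> of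
  \<open>\<bar>\<integral>\<^sub>Q u\<bar>\<close> (\<open>KR_norm_le_dyadic\<close>). The Bessel inequality, applied to the indicators of the \<open>2^(d * j)\<close>
  cells, shows that the squares of \<open>V j\<close> along the sequence sum to \<open>O(2^(d * j))\<close>
  (\<open>bessel_dyadic_mass\<close>), and \<open>V j\<close> is also uniformly bounded, so that the same bound holds for
  \<open>p\<close>-th powers with \<open>2 \<le> p\<close>. The weights \<open>2^-j\<close> then win against \<open>2^(d * j / p)\<close> exactly when
  \<open>d < p\<close> (\<open>summable_powr_of_scales\<close>).

  For the divergence, the sine function with frequency \<open>n\<close>, divided by its Lipschitz constant
  \<open>O(max n)\<close>, is an admissible test function for itself; by orthonormality the norm is at least
  \<open>c / max n\<close> (\<open>KR_norm_sine_product_ge\<close>). The number of even indices with all components in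
  \<open>(2^m, 2^(m + 1)]\<close> is of order \<open>2^(m * d)\<close>, so that the \<open>d\<close>-th powers over such a block sum to at least a positive constant
  (\<open>sine_product_block_sum\<close>), and there are infinitely many disjoint blocks.
\<close>

section \<open>Integration on the cube\<close>

lemma sets_unit_cube [simp]: "(unit_cube :: 'a::euclidean_space set) \<in> sets lebesgue"
  by (simp add: unit_cube_def)

lemma space_cube [simp]: "space (lebesgue_on (unit_cube :: 'a::euclidean_space set)) = unit_cube"
  by simp

lemma measure_unit_cube: "measure lebesgue (unit_cube :: 'a::euclidean_space set) = 1"
  by (simp add: unit_cube_def)

lemma finite_measure_cube: "finite_measure (lebesgue_on (unit_cube :: 'a::euclidean_space set))"
proof (rule finite_measure_lebesgue_on)
  show "(unit_cube :: 'a set) \<in> lmeasurable"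
    by (simp add: unit_cube_def)
qed

lemma borel_measurable_cube:
  "f \<in> borel_measurable borel \<Longrightarrow> f \<in> borel_measurable (lebesgue_on unit_cube)"
  by (simp add: measurable_completion measurable_restrict_space1)

lemma integrable_cube_bounded:
  fixes f :: "'a::euclidean_space \<Rightarrow> real"
  assumes "f \<in> borel_measurable (lebesgue_on unit_cube)" "\<And>x. x \<in> unit_cube \<Longrightarrow> \<bar>f x\<bar> \<le> B"
  shows "integrable (lebesgue_on unit_cube) f"
  by (rule finite_measure.integrable_const_bound[OF finite_measure_cube, of _ B]) (use assms in auto)

lemma integral_cube_const [simp]:
  "(LINT x|lebesgue_on (unit_cube :: 'a::euclidean_space set). c) = (c::real)"
  using measure_unit_cube[where 'a='a] by (simp add: measure_restrict_space)

lemma L2_cubeI_bounded: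
  fixes f :: "'a::euclidean_space \<Rightarrow> real"
  assumes "f \<in> borel_measurable (lebesgue_on unit_cube)" "\<And>x. x \<in> unit_cube \<Longrightarrow> \<bar>f x\<bar> \<le> B"
  shows "f \<in> L2_cube"
proof -
  have "integrable (lebesgue_on unit_cube) (\<lambda>x. (f x)\<^sup>2)"
  proof (rule integrable_cube_bounded)
    show "\<bar>(f x)\<^sup>2\<bar> \<le> B\<^sup>2" if "x \<in> unit_cube" for x
      using power_mono[OF assms(2)[OF that], of 2] by simp
  qed (use assms(1) in measurable)
  then show ?thesis
    using assms(1) by (simp add: L2_cube_def)
qed

text \<open>The cube has finite measure, so \<open>L\<^sup>2\<close> embeds in \<open>L\<^sup>1\<close>; the elementary
  inequality \<open>\<bar>u\<bar> \<le> 1 + u\<^sup>2\<close> gives a bound that is uniform along a Bessel sequence.\<close>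

lemma L2_cube_integrable:
  assumes "u \<in> L2_cube"
  shows "integrable (lebesgue_on unit_cube) u"
    and "(LINT x|lebesgue_on unit_cube. \<bar>u x\<bar>) \<le> 1 + L2_inner u u"
proof -
  have u [measurable]: "u \<in> borel_measurable (lebesgue_on unit_cube)"
    and sq: "integrable (lebesgue_on unit_cube) (\<lambda>x. (u x)\<^sup>2)"
    using assms by (auto simp: L2_cube_def)
  have le: "\<bar>u x\<bar> \<le> 1 + (u x)\<^sup>2" for x
    using sum_squares_bound[of "\<bar>u x\<bar>" 1] zero_le_power2[of "u x"] by (simp del: zero_le_power2)
  have one: "integrable (lebesgue_on (unit_cube :: 'a set)) (\<lambda>x. 1::real)"
    by (rule integrable_cube_bounded[where B=1]) auto
  note dom = Bochner_Integration.integrable_add[OF one sq]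
  show int: "integrable (lebesgue_on unit_cube) u"
    by (rule Bochner_Integration.integrable_bound[OF dom]) (use le in \<open>auto simp: abs_of_nonneg\<close>)
  have "(LINT x|lebesgue_on unit_cube. \<bar>u x\<bar>) \<le> (LINT x|lebesgue_on unit_cube. 1 + (u x)\<^sup>2)"
    by (rule integral_mono) (use int dom le in auto)
  also have "\<dots> = 1 + L2_inner u u"
    using one sq by (simp add: L2_inner_def power2_eq_square del: lebesgue_integral_const)
  finally show "(LINT x|lebesgue_on unit_cube. \<bar>u x\<bar>) \<le> 1 + L2_inner u u" .
qed

lemma integrable_cube_mult:
  fixes u :: "'a::euclidean_space \<Rightarrow> real"
  assumes "integrable (lebesgue_on unit_cube) u" "f \<in> borel_measurable (lebesgue_on unit_cube)"
    "\<And>x. x \<in> unit_cube \<Longrightarrow> \<bar>f x\<bar> \<le> B"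
  shows "integrable (lebesgue_on unit_cube) (\<lambda>x. u x * f x)"
proof (rule Bochner_Integration.integrable_bound)
  show "integrable (lebesgue_on unit_cube) (\<lambda>x. B * u x)"
    using assms(1) by simp
  show "(\<lambda>x. u x * f x) \<in> borel_measurable (lebesgue_on unit_cube)"
    using assms(1,2) by measurable
  have "\<bar>u x * f x\<bar> \<le> \<bar>B * u x\<bar>" if "x \<in> unit_cube" for x
  proof -
    have "\<bar>u x * f x\<bar> \<le> \<bar>u x\<bar> * B"
      unfolding abs_mult using assms(3)[OF that] by (intro mult_left_mono) auto
    also have "\<dots> \<le> \<bar>B * u x\<bar>"
      by (simp add: abs_mult mult.commute mult_right_mono)
    finally show ?thesis .
  qed
  then show "AE x in lebesgue_on unit_cube. norm (u x * f x) \<le> norm (B * u x)"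
    by (intro AE_I2) (simp only: space_cube real_norm_def)
qed

lemma lipschitz_cube_measurable:
  fixes f :: "'a::euclidean_space \<Rightarrow> real"
  assumes "L-lipschitz_on unit_cube f"
  shows "f \<in> borel_measurable (lebesgue_on unit_cube)"
  by (rule continuous_imp_measurable_on_sets_lebesgue)
     (use assms lipschitz_on_continuous_on in auto)

lemma lipschitz_cube_bounded:
  fixes f :: "'a::euclidean_space \<Rightarrow> real"
  assumes "L-lipschitz_on unit_cube f"
  obtains B where "\<And>x. x \<in> unit_cube \<Longrightarrow> \<bar>f x\<bar> \<le> B"
proof -
  have "bounded (f ` unit_cube)"
    by (rule bounded_uniformly_continuous_image)
       (use assms lipschitz_on_uniformly_continuous in \<open>auto simp: unit_cube_def bounded_box\<close>)
  then show ?thesis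
    using that unfolding bounded_iff by (metis imageI real_norm_def)
qed

section \<open>Dyadic cells\<close>

text \<open>Rounding every coordinate to the centre of its dyadic interval of length \<open>2^-j\<close>. Centres, rather
  than corners, are chosen because they stay in the open cube, the only place where a test
  function is known to be Lipschitz.\<close>

definition cell_centre :: "nat \<Rightarrow> 'a::euclidean_space \<Rightarrow> 'a" where
  "cell_centre j x = (\<Sum>b\<in>Basis. ((of_int \<lfloor>2 ^ j * (x \<bullet> b)\<rfloor> + 1/2) / 2 ^ j) *\<^sub>R b)"

lemma cell_centre_inner:
  "b \<in> Basis \<Longrightarrow> cell_centre j x \<bullet> b = (of_int \<lfloor>2 ^ j * (x \<bullet> b)\<rfloor> + 1/2) / 2 ^ j"
  by (simp add: cell_centre_def)

lemma cell_centre_measurable [measurable]: "cell_centre j \<in> borel_measurable borel"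
  unfolding cell_centre_def by measurable

lemma floor_unit_bounds:
  fixes t :: real
  assumes "0 < t" "t < 1"
  shows "0 \<le> \<lfloor>2 ^ j * t\<rfloor>" "\<lfloor>2 ^ j * t\<rfloor> < 2 ^ j"
  using assms by (auto simp: floor_less_iff)

lemma cell_centre_in_cube:
  assumes "x \<in> unit_cube"
  shows "cell_centre j x \<in> unit_cube"
proof -
  have "0 < cell_centre j x \<bullet> b \<and> cell_centre j x \<bullet> b < 1" if b: "b \<in> Basis" for b
  proof -
    have t: "0 < x \<bullet> b" "x \<bullet> b < 1"
      using assms b by (auto simp: unit_cube_def mem_box)
    have "real_of_int (\<lfloor>2 ^ j * (x \<bullet> b)\<rfloor> + 1) \<le> real_of_int (2 ^ j)"
      using floor_unit_bounds(2)[OF t, of j] by (subst of_int_le_iff) simp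
    moreover have "0 \<le> real_of_int \<lfloor>2 ^ j * (x \<bullet> b)\<rfloor>"
      using floor_unit_bounds(1)[OF t, of j] by simp
    ultimately show ?thesis
      by (auto simp: cell_centre_inner[OF b] pos_divide_less_eq simp del: zero_le_floor intro!: divide_pos_pos)
  qed
  then show ?thesis
    by (auto simp: unit_cube_def mem_box)
qed

lemma cell_centre_inner_close:
  assumes "b \<in> Basis"
  shows "\<bar>x \<bullet> b - cell_centre j x \<bullet> b\<bar> \<le> 1 / 2 / 2 ^ j"
proof -
  define s where "s = 2 ^ j * (x \<bullet> b)"
  have "x \<bullet> b - cell_centre j x \<bullet> b = (s - (of_int \<lfloor>s\<rfloor> + 1/2)) / 2 ^ j"
    by (simp add: cell_centre_inner[OF assms] s_def diff_divide_distrib)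
  also have "\<bar>\<dots>\<bar> = \<bar>s - (of_int \<lfloor>s\<rfloor> + 1/2)\<bar> / 2 ^ j"
    by simp
  also have "\<dots> \<le> (1 / 2) / 2 ^ j"
    proof (rule divide_right_mono)
    show "\<bar>s - (of_int \<lfloor>s\<rfloor> + 1/2)\<bar> \<le> 1 / 2"
      by linarith
  qed simp
  finally show ?thesis .
qed

lemma dist_cell_centre:
  "dist x (cell_centre j x) \<le> real DIM('a) * (1/2) ^ j" for x :: "'a::euclidean_space"
proof -
  have "dist x (cell_centre j x) \<le> (\<Sum>b\<in>Basis. \<bar>(x - cell_centre j x) \<bullet> b\<bar>)"
    unfolding dist_norm by (rule norm_le_l1)
  also have "\<dots> \<le> (\<Sum>b\<in>(Basis :: 'a set). (1/2) ^ j)"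
  proof (rule sum_mono)
    fix b :: 'a assume b: "b \<in> Basis"
    have "1 / 2 / (2::real) ^ j \<le> (1/2) ^ j"
      by (simp add: power_one_over divide_simps)
    with cell_centre_inner_close[OF b, of x j]
    show "\<bar>(x - cell_centre j x) \<bullet> b\<bar> \<le> (1/2) ^ j"
      by (simp add: inner_diff_left)
  qed
  finally show ?thesis
    by simp
qed

text \<open>Rounding at the finer scale forgets nothing that the coarser scale sees, because
  \<open>\<lfloor>(\<lfloor>2 * s\<rfloor> + 1/2) / 2\<rfloor> = \<lfloor>s\<rfloor>\<close>. Hence the composition of a function with the rounding at scale
  \<open>j\<close> is also constant on the cells of scale \<open>Suc j\<close>, which makes the telescoping below work.\<close>

lemma cell_centre_refine: "cell_centre j (cell_centre (Suc j) x) = cell_centre j x"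
proof -
  have "\<lfloor>2 ^ j * (cell_centre (Suc j) x \<bullet> b)\<rfloor> = \<lfloor>2 ^ j * (x \<bullet> b)\<rfloor>" if b: "b \<in> Basis" for b
  proof -
    define s :: real where "s = 2 ^ j * (x \<bullet> b)"
    have "2 ^ j * (cell_centre (Suc j) x \<bullet> b) = (of_int \<lfloor>2 * s\<rfloor> + 1/2) / 2"
      by (simp add: cell_centre_inner[OF b] s_def mult.assoc)
    moreover have "\<lfloor>(real_of_int \<lfloor>2 * s\<rfloor> + 1/2) / 2\<rfloor> = \<lfloor>s\<rfloor>"
    proof (rule floor_unique)
      have "2 * \<lfloor>s\<rfloor> \<le> \<lfloor>2 * s\<rfloor>" "\<lfloor>2 * s\<rfloor> \<le> 2 * \<lfloor>s\<rfloor> + 1"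
        by linarith+
      then have "real_of_int (2 * \<lfloor>s\<rfloor>) \<le> of_int \<lfloor>2 * s\<rfloor>"
        "real_of_int \<lfloor>2 * s\<rfloor> \<le> of_int (2 * \<lfloor>s\<rfloor> + 1)"
        by (simp_all only: of_int_le_iff)
      then show "of_int \<lfloor>s\<rfloor> \<le> (real_of_int \<lfloor>2 * s\<rfloor> + 1/2) / 2"
        "(real_of_int \<lfloor>2 * s\<rfloor> + 1/2) / 2 < of_int \<lfloor>s\<rfloor> + 1"
        by simp_all
    qed
    ultimately show ?thesis
      by (simp only: s_def)
  qed
  then show ?thesis
    by (simp add: cell_centre_def)
qed

lemma cell_centre_0:
  assumes "x \<in> unit_cube"
  shows "cell_centre 0 x = (\<Sum>b\<in>Basis. (1/2) *\<^sub>R b)"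
proof -
  have "\<lfloor>x \<bullet> b\<rfloor> = 0" if "b \<in> Basis" for b
    using assms that by (auto simp: unit_cube_def mem_box floor_eq_iff less_imp_le)
  then show ?thesis
    by (simp add: cell_centre_def)
qed

text \<open>A centre is determined by the integer parts of \<open>2^j\<close> times the coordinates, each of which takes at
  most \<open>2^j\<close> values on the cube.\<close>

lemma cells_finite_card:
  "finite (cell_centre j ` (unit_cube :: 'a::euclidean_space set))"
  "card (cell_centre j ` (unit_cube :: 'a::euclidean_space set)) \<le> (2 ^ DIM('a)) ^ j"
proof -
  define F where "F = (Basis :: 'a set) \<rightarrow>\<^sub>E {0..<(2::int) ^ j}"
  define g where "g \<phi> = (\<Sum>b\<in>Basis. ((of_int (\<phi> b) + 1/2) / 2 ^ j) *\<^sub>R b)" for \<phi> :: "'a \<Rightarrow> int"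
  have F: "finite F" "card F = (2 ^ j) ^ DIM('a)"
    by (auto simp: F_def finite_PiE card_PiE nat_power_eq)
  have sub: "cell_centre j ` (unit_cube :: 'a set) \<subseteq> g ` F"
  proof safe
    fix x :: 'a assume x: "x \<in> unit_cube"
    let ?\<phi> = "restrict (\<lambda>b. \<lfloor>2 ^ j * (x \<bullet> b)\<rfloor>) Basis"
    have "?\<phi> \<in> F"
      using x floor_unit_bounds by (auto simp: F_def unit_cube_def mem_box)
    moreover have "cell_centre j x = g ?\<phi>"
      by (simp add: cell_centre_def g_def)
    ultimately show "cell_centre j x \<in> g ` F"
      by blast
  qed
  show "finite (cell_centre j ` (unit_cube :: 'a set))"
    using sub F finite_subset by blast
  have "card (cell_centre j ` (unit_cube :: 'a set)) \<le> card F"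
    using sub F surj_card_le by blast
  then show "card (cell_centre j ` (unit_cube :: 'a set)) \<le> (2 ^ DIM('a)) ^ j"
    by (simp add: F power_mult[symmetric] mult.commute)
qed

definition cell :: "nat \<Rightarrow> 'a::euclidean_space \<Rightarrow> 'a set" where
  "cell j c = {x. cell_centre j x = c}"

lemma cell_borel [measurable]: "cell j c \<in> sets borel"
proof -
  have "cell j c = cell_centre j -` {c} \<inter> space borel"
    by (auto simp: cell_def)
  also have "\<dots> \<in> sets borel"
    by (rule measurable_sets[OF cell_centre_measurable]) auto
  finally show ?thesis .
qed

lemma cell_indicator_measurable [measurable]:
  "(indicator (cell j c) :: 'a::euclidean_space \<Rightarrow> real) \<in> borel_measurable (lebesgue_on unit_cube)"
  by (rule borel_measurable_cube) measurable

lemma cell_volume: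
  fixes c :: "'a::euclidean_space"
  shows "(LINT x|lebesgue_on unit_cube. indicator (cell j c) x) \<le> (1 / 2 ^ DIM('a) :: real) ^ j"
proof -
  define e :: 'a where "e = (1 / 2 / 2 ^ j) *\<^sub>R One"
  have [simp]: "e \<bullet> b = 1 / 2 / 2 ^ j" if "b \<in> Basis" for b
    using that by (simp add: e_def)
  have sub: "cell j c \<subseteq> cbox (c - e) (c + e)"
  proof
    fix x assume "x \<in> cell j c"
    then have c: "cell_centre j x = c"
      by (simp add: cell_def)
    show "x \<in> cbox (c - e) (c + e)"
      unfolding mem_box
    proof
      fix b :: 'a assume b: "b \<in> Basis"
      show "(c - e) \<bullet> b \<le> x \<bullet> b \<and> x \<bullet> b \<le> (c + e) \<bullet> b"
        using cell_centre_inner_close[OF b, of x j] b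
        unfolding c by (auto simp: inner_diff_left inner_add_left abs_le_iff)
    qed
  qed
  have meas: "cell j c \<in> sets lebesgue"
    using cell_borel by (metis sets_completionI_sets sets_lborel)
  have "(LINT x|lebesgue_on unit_cube. indicator (cell j c) x :: real)
      = (LINT x|lebesgue. indicator (unit_cube \<inter> cell j c) x)"
    by (subst integral_restrict_space) (simp_all add: indicator_inter_arith[abs_def])
  also have "\<dots> = measure lebesgue (unit_cube \<inter> cell j c)"
    using meas by simp
  also have "\<dots> \<le> measure lebesgue (cbox (c - e) (c + e))"
    by (rule measure_mono_fmeasurable) (use sub meas in auto)
  also have "\<dots> = (\<Prod>b\<in>(Basis :: 'a set). 1 / 2 ^ j)"
    by (subst measure_completion) (simp_all add: measure_lborel_cbox_eq inner_diff_left inner_add_left)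
  also have "\<dots> = (1 / 2 ^ DIM('a)) ^ j"
    by (simp add: power_one_over power_mult[symmetric] mult.commute)
  finally show ?thesis .
qed

section \<open>Transport estimate over dyadic scales\<close>

text \<open>The \<open>L\<^sup>1\<close> norm of the conditional expectation of \<open>u\<close> on the dyadic cells of scale \<open>j\<close>.\<close>

definition dyadic_mass :: "nat \<Rightarrow> ('a::euclidean_space \<Rightarrow> real) \<Rightarrow> real" where
  "dyadic_mass j u =
    (\<Sum>c\<in>cell_centre j ` unit_cube. \<bar>LINT x|lebesgue_on unit_cube. u x * indicator (cell j c) x\<bar>)"

lemma dyadic_mass_nonneg: "0 \<le> dyadic_mass j u"
  by (simp add: dyadic_mass_def sum_nonneg)

lemma cellwise_eq_sum:
  fixes h :: "'a::euclidean_space \<Rightarrow> real"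
  assumes "x \<in> unit_cube"
  shows "h (cell_centre j x) = (\<Sum>c\<in>cell_centre j ` unit_cube. h c * indicator (cell j c) x)"
proof -
  have "(\<Sum>c\<in>cell_centre j ` unit_cube. h c * indicator (cell j c) x)
      = (\<Sum>c\<in>cell_centre j ` unit_cube. if c = cell_centre j x then h c else 0)"
    by (rule sum.cong) (auto simp: cell_def indicator_def)
  also have "\<dots> = h (cell_centre j x)"
    using assms by (simp add: cells_finite_card sum.delta)
  finally show ?thesis ..
qed

lemma integrable_mult_cell:
  fixes u :: "'a::euclidean_space \<Rightarrow> real"
  assumes "integrable (lebesgue_on unit_cube) u"
  shows "integrable (lebesgue_on unit_cube) (\<lambda>x. u x * indicator (cell j c) x)"
  by (rule integrable_cube_mult[where B=1, OF assms cell_indicator_measurable]) (simp add: indicator_def)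

lemma integral_cellwise:
  fixes h :: "'a::euclidean_space \<Rightarrow> real"
  assumes "integrable (lebesgue_on unit_cube) u"
  shows "(LINT x|lebesgue_on unit_cube. u x * h (cell_centre j x)) =
    (\<Sum>c\<in>cell_centre j ` unit_cube. h c * (LINT x|lebesgue_on unit_cube. u x * indicator (cell j c) x))"
proof -
  have "(LINT x|lebesgue_on unit_cube. u x * h (cell_centre j x)) =
    (LINT x|lebesgue_on unit_cube.
      (\<Sum>c\<in>cell_centre j ` unit_cube. h c * (u x * indicator (cell j c) x)))"
  proof (rule Bochner_Integration.integral_cong[OF refl])
    fix x :: 'a assume "x \<in> space (lebesgue_on unit_cube)"
    then have "x \<in> unit_cube"
      by (simp only: space_cube)
    from cellwise_eq_sum[OF this, of h j]
    show "u x * h (cell_centre j x) = (\<Sum>c\<in>cell_centre j ` unit_cube. h c * (u x * indicator (cell j c) x))"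
      by (simp add: sum_distrib_left mult.left_commute)
  qed
  also have "\<dots> = (\<Sum>c\<in>cell_centre j ` unit_cube. LINT x|lebesgue_on unit_cube. h c * (u x * indicator (cell j c) x))"
    by (intro Bochner_Integration.integral_sum integrable_mult_right integrable_mult_cell assms)
  finally show ?thesis
    by simp
qed

lemma integral_cellwise_le:
  fixes h :: "'a::euclidean_space \<Rightarrow> real"
  assumes "integrable (lebesgue_on unit_cube) u" "\<And>x. x \<in> unit_cube \<Longrightarrow> \<bar>h (cell_centre j x)\<bar> \<le> C"
  shows "\<bar>LINT x|lebesgue_on unit_cube. u x * h (cell_centre j x)\<bar> \<le> C * dyadic_mass j u"
  unfolding integral_cellwise[OF assms(1)] dyadic_mass_def sum_distrib_left
proof (rule order_trans[OF sum_abs], rule sum_mono)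
  fix c :: 'a assume "c \<in> cell_centre j ` unit_cube"
  then have "\<bar>h c\<bar> \<le> C"
    using assms(2) by auto
  then show "\<bar>h c * (LINT x|lebesgue_on unit_cube. u x * indicator (cell j c) x)\<bar>
     \<le> C * \<bar>LINT x|lebesgue_on unit_cube. u x * indicator (cell j c) x\<bar>"
    by (simp add: abs_mult mult_right_mono)
qed

lemma integrable_cellwise:
  fixes h :: "'a::euclidean_space \<Rightarrow> real"
  assumes "integrable (lebesgue_on unit_cube) u"
  shows "integrable (lebesgue_on unit_cube) (\<lambda>x. u x * h (cell_centre j x))"
proof -
  have "integrable (lebesgue_on unit_cube)
      (\<lambda>x. \<Sum>c\<in>cell_centre j ` unit_cube. h c * (u x * indicator (cell j c) x))"
    by (intro Bochner_Integration.integrable_sum integrable_mult_right integrable_mult_cell assms)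
  also have "?this \<longleftrightarrow> ?thesis"
  proof (rule Bochner_Integration.integrable_cong[OF refl])
    fix x :: 'a assume "x \<in> space (lebesgue_on unit_cube)"
    then have "x \<in> unit_cube"
      by (simp only: space_cube)
    from cellwise_eq_sum[OF this, of h j]
    show "(\<Sum>c\<in>cell_centre j ` unit_cube. h c * (u x * indicator (cell j c) x)) = u x * h (cell_centre j x)"
      by (simp add: sum_distrib_left mult.left_commute)
  qed
  finally show ?thesis .
qed

lemma dyadic_mass_le_L1:
  fixes u :: "'a::euclidean_space \<Rightarrow> real"
  assumes "integrable (lebesgue_on unit_cube) u"
  shows "dyadic_mass j u \<le> (LINT x|lebesgue_on unit_cube. \<bar>u x\<bar>)"
proof -
  have "dyadic_mass j u \<le>
    (\<Sum>c\<in>cell_centre j ` (unit_cube :: 'a set). LINT x|lebesgue_on unit_cube. \<bar>u x\<bar> * indicator (cell j c) x)"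
    unfolding dyadic_mass_def
  proof (rule sum_mono)
    fix c :: 'a
    have "\<bar>LINT x|lebesgue_on unit_cube. u x * indicator (cell j c) x\<bar>
      \<le> (LINT x|lebesgue_on unit_cube. \<bar>u x * indicator (cell j c) x\<bar>)"
      by (rule integral_abs_bound)
    then show "\<bar>LINT x|lebesgue_on unit_cube. u x * indicator (cell j c) x\<bar>
      \<le> (LINT x|lebesgue_on unit_cube. \<bar>u x\<bar> * indicator (cell j c) x)"
      by (simp add: abs_mult)
  qed
  also have "\<dots> = (LINT x|lebesgue_on unit_cube. \<bar>u x\<bar>)"
    using integral_cellwise[of "\<lambda>x. \<bar>u x\<bar>" "\<lambda>_. 1" j] assms by simp
  finally show ?thesis .
qed

text \<open>Passing from scale \<open>J\<close> to scale \<open>Suc J\<close> changes the rounded test function by at most its Lipschitz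
  constant times the distance \<open>O(2^-J)\<close> of two neighbouring centres, and the change is constant on
  the cells of scale \<open>Suc J\<close>: the cost of this step is therefore controlled by the dyadic mass.
  At scale \<open>0\<close> there is a single cell and the mean of \<open>u\<close> vanishes.\<close>

lemma transport_telescope:
  fixes u f :: "'a::euclidean_space \<Rightarrow> real"
  assumes u: "integrable (lebesgue_on unit_cube) u" "(LINT x|lebesgue_on unit_cube. u x) = 0"
    and f: "1-lipschitz_on unit_cube f"
  shows "(LINT x|lebesgue_on unit_cube. u x * f (cell_centre J x))
    \<le> real DIM('a) * (\<Sum>j<J. (1/2) ^ j * dyadic_mass (Suc j) u)"
proof (induction J)
  case 0
  have "(LINT x|lebesgue_on unit_cube. u x * f (cell_centre 0 x))
      = (LINT x|lebesgue_on unit_cube. u x * f (\<Sum>b\<in>Basis. (1/2) *\<^sub>R b))"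
    by (rule Bochner_Integration.integral_cong[OF refl]) (simp only: space_cube cell_centre_0)
  then show ?case
    using u(2) by simp
next
  case (Suc J)
  define h where "h c = f c - f (cell_centre J c)" for c
  have "\<bar>LINT x|lebesgue_on unit_cube. u x * h (cell_centre (Suc J) x)\<bar>
      \<le> (real DIM('a) * (1/2) ^ J) * dyadic_mass (Suc J) u"
  proof (rule integral_cellwise_le[OF u(1)])
    fix x :: 'a assume "x \<in> unit_cube"
    then have c: "cell_centre (Suc J) x \<in> unit_cube"
      by (rule cell_centre_in_cube)
    have "\<bar>h (cell_centre (Suc J) x)\<bar> \<le> 1 * dist (cell_centre (Suc J) x) (cell_centre J (cell_centre (Suc J) x))"
      unfolding h_def dist_real_def[symmetric]
      by (rule lipschitz_onD[OF f]) (use c cell_centre_in_cube in auto)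
    with dist_cell_centre[of "cell_centre (Suc J) x" J]
    show "\<bar>h (cell_centre (Suc J) x)\<bar> \<le> real DIM('a) * (1/2) ^ J"
      by simp
  qed
  moreover have "(LINT x|lebesgue_on unit_cube. u x * h (cell_centre (Suc J) x))
      = (LINT x|lebesgue_on unit_cube. u x * f (cell_centre (Suc J) x))
        - (LINT x|lebesgue_on unit_cube. u x * f (cell_centre J x))"
    by (simp add: h_def cell_centre_refine right_diff_distrib integrable_cellwise u(1))
  ultimately show ?case
    using Suc.IH by (simp add: distrib_left mult.assoc)
qed

lemma dyadic_mass_series_summable:
  fixes u :: "'a::euclidean_space \<Rightarrow> real"
  assumes "integrable (lebesgue_on unit_cube) u"
  shows "summable (\<lambda>j. (1/2) ^ j * dyadic_mass (Suc j) u)"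
proof (rule summable_comparison_test)
  show "summable (\<lambda>j. (1/2) ^ j * (LINT x|lebesgue_on unit_cube. \<bar>u x\<bar>))"
    by (intro summable_mult2 summable_geometric) simp
  show "\<exists>N. \<forall>j\<ge>N. norm ((1/2) ^ j * dyadic_mass (Suc j) u)
      \<le> (1/2) ^ j * (LINT x|lebesgue_on unit_cube. \<bar>u x\<bar>)"
    using dyadic_mass_le_L1[OF assms] dyadic_mass_nonneg[of _ u] by (auto simp: abs_mult)
qed

text \<open>The rounded test functions converge uniformly to \<open>f\<close>, so the telescoping estimate passes to the
  limit.\<close>

lemma integral_lipschitz_le_dyadic:
  fixes u f :: "'a::euclidean_space \<Rightarrow> real"
  assumes u: "integrable (lebesgue_on unit_cube) u" "(LINT x|lebesgue_on unit_cube. u x) = 0"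
    and f: "1-lipschitz_on unit_cube f"
  shows "(LINT x|lebesgue_on unit_cube. u x * f x)
    \<le> real DIM('a) * (\<Sum>j. (1/2) ^ j * dyadic_mass (Suc j) u)" (is "?I \<le> ?S")
proof -
  define L where "L = (LINT x|lebesgue_on unit_cube. \<bar>u x\<bar>)"
  obtain B where B: "\<And>x. x \<in> unit_cube \<Longrightarrow> \<bar>f x\<bar> \<le> B"
    using lipschitz_cube_bounded[OF f] by blast
  have int: "integrable (lebesgue_on unit_cube) (\<lambda>x. u x * f x)"
    by (rule integrable_cube_mult[OF u(1) lipschitz_cube_measurable[OF f] B])
  have step: "?I \<le> ?S + (real DIM('a) * L) * (1/2) ^ J" for J
  proof -
    have "?I - (LINT x|lebesgue_on unit_cube. u x * f (cell_centre J x))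
       = (LINT x|lebesgue_on unit_cube. u x * f x - u x * f (cell_centre J x))"
      by (simp add: int integrable_cellwise u(1))
    also have "\<dots> \<le> (LINT x|lebesgue_on unit_cube. real DIM('a) * (1/2) ^ J * \<bar>u x\<bar>)"
    proof (rule integral_mono)
      fix x :: 'a assume "x \<in> space (lebesgue_on unit_cube)"
      then have x: "x \<in> unit_cube"
        by (simp only: space_cube)
      have "u x * f x - u x * f (cell_centre J x) \<le> \<bar>u x\<bar> * \<bar>f x - f (cell_centre J x)\<bar>"
        by (metis abs_ge_self abs_mult right_diff_distrib)
      also have "\<dots> \<le> \<bar>u x\<bar> * (1 * dist x (cell_centre J x))"
        unfolding dist_real_def[symmetric]
        by (intro mult_left_mono lipschitz_onD[OF f]) (use x cell_centre_in_cube in auto)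
      also have "\<dots> \<le> \<bar>u x\<bar> * (real DIM('a) * (1/2) ^ J)"
        using dist_cell_centre[of x J] by (intro mult_left_mono) auto
      finally show "u x * f x - u x * f (cell_centre J x) \<le> real DIM('a) * (1/2) ^ J * \<bar>u x\<bar>"
        by (simp add: mult.commute)
    qed (use int integrable_cellwise[OF u(1)] u(1) in auto)
    also have "\<dots> = (real DIM('a) * L) * (1/2) ^ J"
      by (simp add: L_def)
    finally have "?I \<le> (LINT x|lebesgue_on unit_cube. u x * f (cell_centre J x)) + (real DIM('a) * L) * (1/2) ^ J"
      by simp
    moreover have "(\<Sum>j<J. (1/2) ^ j * dyadic_mass (Suc j) u) \<le> (\<Sum>j. (1/2) ^ j * dyadic_mass (Suc j) u)"
      by (rule sum_le_suminf[OF dyadic_mass_series_summable[OF u(1)]]) (auto simp: dyadic_mass_nonneg)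
    then have "real DIM('a) * (\<Sum>j<J. (1/2) ^ j * dyadic_mass (Suc j) u) \<le> ?S"
      by (rule mult_left_mono) simp
    ultimately show ?thesis
      using transport_telescope[OF u f, of J] by linarith
  qed
  have "(\<lambda>J. ?S + (real DIM('a) * L) * (1/2) ^ J) \<longlonglongrightarrow> ?S + (real DIM('a) * L) * 0"
    by (intro tendsto_intros LIMSEQ_power_zero) simp
  from LIMSEQ_le_const[OF this] step show ?thesis
    by auto
qed

lemma KR_bdd_above:
  fixes u :: "'a::euclidean_space \<Rightarrow> real"
  assumes u: "integrable (lebesgue_on unit_cube) u" "(LINT x|lebesgue_on unit_cube. u x) = 0"
  shows "bdd_above {LINT x|lebesgue_on unit_cube. u x * f x | f. 1-lipschitz_on unit_cube f}"
  using integral_lipschitz_le_dyadic[OF u] by (auto intro!: bdd_aboveI)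

lemma integral_le_KR_norm:
  fixes u :: "'a::euclidean_space \<Rightarrow> real"
  assumes u: "integrable (lebesgue_on unit_cube) u" "(LINT x|lebesgue_on unit_cube. u x) = 0"
    and f: "1-lipschitz_on unit_cube f"
  shows "(LINT x|lebesgue_on unit_cube. u x * f x) \<le> KR_norm u"
  unfolding KR_norm_def by (rule cSup_upper[OF _ KR_bdd_above[OF u]]) (use f in blast)

lemma KR_norm_nonneg:
  fixes u :: "'a::euclidean_space \<Rightarrow> real"
  assumes u: "integrable (lebesgue_on unit_cube) u" "(LINT x|lebesgue_on unit_cube. u x) = 0"
  shows "0 \<le> KR_norm u"
  using integral_le_KR_norm[OF u, of "\<lambda>_. 0"] by (simp add: lipschitz_on_def)

lemma KR_norm_le_dyadic:
  fixes u :: "'a::euclidean_space \<Rightarrow> real"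
  assumes u: "integrable (lebesgue_on unit_cube) u" "(LINT x|lebesgue_on unit_cube. u x) = 0"
  shows "KR_norm u \<le> real DIM('a) * (\<Sum>j. (1/2) ^ j * dyadic_mass (Suc j) u)"
  unfolding KR_norm_def
proof (rule cSup_least)
  have "1-lipschitz_on (unit_cube :: 'a set) (\<lambda>_. 0 :: real)"
    by (simp add: lipschitz_on_def)
  then show "{LINT x|lebesgue_on unit_cube. u x * f x | f. 1-lipschitz_on unit_cube f} \<noteq> {}"
    by blast
qed (use integral_lipschitz_le_dyadic[OF u] in blast)

section \<open>Bessel sequences at a fixed scale\<close>

text \<open>The second bound results from testing the Bessel inequality on \<open>u k\<close> itself and keeping only the
  \<open>k\<close>-th term: \<open>\<parallel>u k\<parallel>\<^sup>4 \<le> B\<^sup>2 * \<parallel>u k\<parallel>\<^sup>2\<close>.\<close>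

lemma bessel_sequence_bounds:
  fixes u :: "nat \<Rightarrow> 'a::euclidean_space \<Rightarrow> real"
  assumes "bessel_sequence u"
  obtains B where "\<And>f K. f \<in> L2_0 \<Longrightarrow> (\<Sum>k<K. (L2_inner f (u k))\<^sup>2) \<le> B\<^sup>2 * L2_inner f f"
    and "\<And>k. L2_inner (u k) (u k) \<le> B\<^sup>2"
proof -
  have u: "u k \<in> L2_0" for k
    using assms by (simp add: bessel_sequence_def)
  obtain B where "\<forall>f\<in>L2_0. summable (\<lambda>k. \<bar>L2_inner f (u k)\<bar>\<^sup>2) \<and>
      (\<Sum>k. \<bar>L2_inner f (u k)\<bar>\<^sup>2) \<le> B\<^sup>2 * (L2_norm_cube f)\<^sup>2"
    using assms unfolding bessel_sequence_def by (elim conjE exE)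
  then have B: "summable (\<lambda>k. \<bar>L2_inner f (u k)\<bar>\<^sup>2)"
      "(\<Sum>k. \<bar>L2_inner f (u k)\<bar>\<^sup>2) \<le> B\<^sup>2 * (L2_norm_cube f)\<^sup>2" if "f \<in> L2_0" for f
    using that by (simp_all only:)
  have sq: "(L2_norm_cube f)\<^sup>2 = L2_inner f f" "0 \<le> L2_inner f f" for f :: "'a \<Rightarrow> real"
    unfolding L2_norm_cube_def by (simp_all add: L2_inner_def)
  have fin: "sum (\<lambda>k. (L2_inner f (u k))\<^sup>2) A \<le> B\<^sup>2 * L2_inner f f" if "f \<in> L2_0" "finite A" for f A
  proof -
    have "sum (\<lambda>k. \<bar>L2_inner f (u k)\<bar>\<^sup>2) A \<le> (\<Sum>k. \<bar>L2_inner f (u k)\<bar>\<^sup>2)"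
      by (rule sum_le_suminf[OF B(1)[OF that(1)] that(2)]) auto
    with B(2)[OF that(1)] show ?thesis
      by (simp add: sq)
  qed
  have "L2_inner (u k) (u k) \<le> B\<^sup>2" for k
  proof (cases "L2_inner (u k) (u k) = 0")
    case False
    then have "0 < L2_inner (u k) (u k)"
      using sq(2)[of "u k"] by linarith
    with fin[OF u, of "{k}" k] show ?thesis
      by (simp add: power2_eq_square)
  qed simp
  with fin that show ?thesis
    by blast
qed

text \<open>The Bessel inequality is tested on the indicator of a cell minus its mean \<open>m\<close>. Removing the mean
  does not change the inner products with functions of mean zero, and the squared norm becomes
  \<open>m - m\<^sup>2\<close>, at most the volume \<open>m\<close> of the cell.\<close>

lemma bessel_cell:
  fixes u :: "nat \<Rightarrow> 'a::euclidean_space \<Rightarrow> real"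
  assumes u: "\<And>k. u k \<in> L2_0"
    and B: "\<And>f K. f \<in> L2_0 \<Longrightarrow> (\<Sum>k<K. (L2_inner f (u k))\<^sup>2) \<le> B\<^sup>2 * L2_inner f f"
  shows "(\<Sum>k<K. (LINT x|lebesgue_on unit_cube. u k x * indicator (cell j c) x)\<^sup>2)
    \<le> B\<^sup>2 * (1 / 2 ^ DIM('a)) ^ j"
proof -
  define m where "m = (LINT x|lebesgue_on (unit_cube :: 'a set). indicator (cell j c) x :: real)"
  define f :: "'a \<Rightarrow> real" where "f x = indicator (cell j c) x - m" for x
  have ind: "integrable (lebesgue_on unit_cube) (indicator (cell j c) :: 'a \<Rightarrow> real)"
    by (rule integrable_cube_bounded[where B=1, OF cell_indicator_measurable]) (simp add: indicator_def)
  have const: "integrable (lebesgue_on (unit_cube :: 'a set)) (\<lambda>_. a :: real)" for a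
    by (rule integrable_cube_bounded[where B="\<bar>a\<bar>"]) auto
  have fm: "f \<in> borel_measurable (lebesgue_on unit_cube)"
    unfolding f_def by measurable
  have "f \<in> L2_cube"
    by (rule L2_cubeI_bounded[OF fm, where B="1 + \<bar>m\<bar>"]) (auto simp: f_def indicator_def)
  moreover have "(LINT x|lebesgue_on unit_cube. f x) = 0"
    unfolding f_def
    by (subst Bochner_Integration.integral_diff[OF ind const]) (simp only: m_def[symmetric] integral_cube_const)
  ultimately have f: "f \<in> L2_0"
    by (simp add: L2_0_def)
  have inner: "L2_inner f (u k) = (LINT x|lebesgue_on unit_cube. u k x * indicator (cell j c) x)" for k
  proof -
    have int: "integrable (lebesgue_on unit_cube) (u k)" and zero: "(LINT x|lebesgue_on unit_cube. u k x) = 0"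
      using u[of k] L2_cube_integrable by (auto simp: L2_0_def)
    have "L2_inner f (u k) = (LINT x|lebesgue_on unit_cube. u k x * indicator (cell j c) x - m * u k x)"
      by (simp add: L2_inner_def f_def algebra_simps)
    also have "\<dots> = (LINT x|lebesgue_on unit_cube. u k x * indicator (cell j c) x)"
      using int zero by (simp add: integrable_mult_cell)
    finally show ?thesis .
  qed
  have "L2_inner f f = (LINT x|lebesgue_on (unit_cube :: 'a set). (1 - 2 * m) * indicator (cell j c) x + m\<^sup>2)"
    unfolding L2_inner_def
    by (rule Bochner_Integration.integral_cong[OF refl]) (simp add: f_def indicator_def power2_eq_square algebra_simps)
  also have "\<dots> = (1 - 2 * m) * m + m\<^sup>2"
    by (subst Bochner_Integration.integral_add[OF integrable_mult_right[OF ind] const])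
       (simp only: m_def[symmetric] integral_cube_const integral_mult_right_zero)
  also have "\<dots> \<le> m"
    by (simp add: power2_eq_square algebra_simps)
  also have "\<dots> \<le> (1 / 2 ^ DIM('a)) ^ j"
    unfolding m_def by (rule cell_volume)
  finally have "B\<^sup>2 * L2_inner f f \<le> B\<^sup>2 * (1 / 2 ^ DIM('a)) ^ j"
    by (rule mult_left_mono) simp
  with B[OF f, of K] show ?thesis
    unfolding inner by linarith
qed

text \<open>By Cauchy--Schwarz over the cells, of which there are at most \<open>2^(d * j)\<close>, each contributing at most
  \<open>B\<^sup>2 * 2^(- d * j)\<close> to the sum over \<open>k\<close>.\<close>

lemma bessel_dyadic_mass:
  fixes u :: "nat \<Rightarrow> 'a::euclidean_space \<Rightarrow> real"
  assumes u: "\<And>k. u k \<in> L2_0"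
    and B: "\<And>f K. f \<in> L2_0 \<Longrightarrow> (\<Sum>k<K. (L2_inner f (u k))\<^sup>2) \<le> B\<^sup>2 * L2_inner f f"
  shows "(\<Sum>k<K. (dyadic_mass j (u k))\<^sup>2) \<le> B\<^sup>2 * (2 ^ DIM('a)) ^ j"
proof -
  define C where "C = cell_centre j ` (unit_cube :: 'a set)"
  define T where "T k c = \<bar>LINT x|lebesgue_on unit_cube. u k x * indicator (cell j c) x\<bar>" for k c
  have C: "finite C" and "card C \<le> (2 ^ DIM('a)) ^ j"
    by (auto simp: C_def cells_finite_card)
  then have card: "real (card C) \<le> (2 ^ DIM('a)) ^ j"
    using of_nat_mono[where 'a=real] by fastforce
  have "(\<Sum>k<K. (dyadic_mass j (u k))\<^sup>2) = (\<Sum>k<K. (\<Sum>c\<in>C. T k c)\<^sup>2)"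
    by (simp add: dyadic_mass_def C_def T_def)
  also have "\<dots> \<le> (\<Sum>k<K. real (card C) * (\<Sum>c\<in>C. (T k c)\<^sup>2))"
    by (intro sum_mono) (metis mult.commute sum_squared_le_sum_of_squares)
  also have "\<dots> = real (card C) * (\<Sum>c\<in>C. \<Sum>k<K. (T k c)\<^sup>2)"
    by (simp add: sum_distrib_left[symmetric] sum.swap[of _ C])
  also have "\<dots> \<le> real (card C) * (\<Sum>c\<in>C. B\<^sup>2 * (1 / 2 ^ DIM('a)) ^ j)"
    by (intro mult_left_mono sum_mono) (simp_all only: T_def power2_abs bessel_cell[OF u B] of_nat_0_le_iff)
  also have "\<dots> = (real (card C))\<^sup>2 * (B\<^sup>2 * (1 / 2 ^ DIM('a)) ^ j)"
    by (simp add: power2_eq_square)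
  also have "\<dots> \<le> ((2 ^ DIM('a)) ^ j)\<^sup>2 * (B\<^sup>2 * (1 / 2 ^ DIM('a)) ^ j)"
    using card by (intro mult_right_mono power_mono) auto
  also have "\<dots> = B\<^sup>2 * (2 ^ DIM('a)) ^ j"
  proof -
    define q :: real where "q = (2 ^ DIM('a)) ^ j"
    have "q \<noteq> 0" "(1 / 2 ^ DIM('a) :: real) ^ j = 1 / q"
      by (simp_all add: q_def power_one_over)
    then show ?thesis
      unfolding q_def[symmetric] by (simp add: power2_eq_square)
  qed
  finally show ?thesis .
qed

section \<open>Summation over scales\<close>

text \<open>Each \<open>y j\<close> is bounded by the \<open>\<ell>\<^sup>p\<close> norm of the sequence, and the geometric weights are summable.\<close>

lemma geometric_series_le_lp:
  fixes s :: real and y :: "nat \<Rightarrow> real"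
  assumes s: "0 < s" "s < 1" and p: "0 < p"
    and y: "\<And>j. 0 \<le> y j" "summable (\<lambda>j. y j powr p)"
    and x: "0 \<le> x" "x \<le> C * (\<Sum>j. s ^ j * y j)" and C: "0 \<le> C"
  shows "x powr p \<le> (C / (1 - s)) powr p * (\<Sum>j. y j powr p)"
proof -
  define S where "S = (\<Sum>j. y j powr p)"
  have S: "0 \<le> S"
    unfolding S_def by (intro suminf_nonneg y) auto
  have le: "y j \<le> S powr (1/p)" for j
  proof -
    have "y j powr p \<le> S"
      unfolding S_def using sum_le_suminf[OF y(2), of "{j}"] by simp
    then have "(y j powr p) powr (1/p) \<le> S powr (1/p)"
      using p by (intro powr_mono2) auto
    then show ?thesis
      using p y(1)[of j] by (simp add: powr_powr)
  qed
  have geo: "summable (\<lambda>j. s ^ j * S powr (1/p))"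
    using s by (intro summable_mult2 summable_geometric) simp
  have step: "s ^ j * y j \<le> s ^ j * S powr (1/p)" for j
    using s le by (intro mult_left_mono) auto
  have "summable (\<lambda>j. s ^ j * y j)"
    by (rule summable_comparison_test'[OF geo]) (use s y(1) step in \<open>auto simp: abs_mult\<close>)
  then have "(\<Sum>j. s ^ j * y j) \<le> (\<Sum>j. s ^ j * S powr (1/p))"
    by (intro suminf_le step geo)
  also have "\<dots> = 1 / (1 - s) * S powr (1/p)"
    using s by (simp add: suminf_mult2[symmetric] summable_geometric suminf_geometric)
  finally have "C * (\<Sum>j. s ^ j * y j) \<le> C * (1 / (1 - s) * S powr (1/p))"
    using C by (rule mult_left_mono)
  with x(2) have "x \<le> C / (1 - s) * S powr (1/p)"
    by simp
  then have "x powr p \<le> (C / (1 - s) * S powr (1/p)) powr p"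
    using x(1) p by (intro powr_mono2) auto
  also have "\<dots> = (C / (1 - s)) powr p * S"
    using s C S p by (subst powr_mult) (simp_all add: powr_powr)
  finally show ?thesis
    by (simp add: S_def)
qed

text \<open>Raising the uniform bound \<open>V \<le> M\<close> to the power \<open>p - 2\<close> turns the quadratic estimate at scale \<open>j\<close> into
  \<open>\<Sum>\<^sub>k V\<^sup>p = O(2^(d * j))\<close>. The factor \<open>2^-j\<close> is split as \<open>s^j * t^j\<close>: the part \<open>s^j\<close> makes the series
  over scales converge, while \<open>t^(p * j)\<close> has to beat \<open>2^(d * j)\<close>. Both are possible at the same time
  precisely because \<open>d < p\<close>.\<close>

lemma summable_powr_of_scales:
  fixes X :: "nat \<Rightarrow> real" and V :: "nat \<Rightarrow> nat \<Rightarrow> real"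
  assumes X: "\<And>k. 0 \<le> X k" "\<And>k. X k \<le> C * (\<Sum>j. (1/2) ^ j * V j k)" and C: "0 \<le> C"
    and V: "\<And>j k. 0 \<le> V j k" "\<And>j k. V j k \<le> M"
    and ell2: "\<And>j K. (\<Sum>k<K. (V j k)\<^sup>2) \<le> A * (2 ^ d) ^ j"
    and p: "2 \<le> p" "real d < p"
  shows "summable (\<lambda>k. X k powr p)"
proof -
  \<comment> \<open>Any exponent strictly between \<open>d / p\<close> and \<open>1\<close> serves; this is the midpoint.\<close>
  define \<tau> where "\<tau> = (d / p + 1) / 2"
  define s t :: real where "s = 2 powr (\<tau> - 1)" and "t = 2 powr (- \<tau>)"
  have dp: "d / p < 1" "0 \<le> d / p"
    using p by auto
  then have tau: "0 < \<tau>" "\<tau> < 1"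
    by (auto simp: \<tau>_def)
  have s: "0 < s" "s < 1"
    using tau powr_less_mono[of "\<tau> - 1" 0 2] by (auto simp: s_def)
  have t: "0 < t" "t < 1"
    using tau powr_less_mono[of "- \<tau>" 0 2] by (auto simp: t_def)
  have st: "s * t = 1/2"
    by (simp add: s_def t_def powr_add[symmetric])
  define r where "r = t powr p"
  have r: "0 < r" "r < 1"
    using t p powr_less_mono2[of p t 1] by (auto simp: r_def)
  have rd: "r * 2 ^ d < 1"
  proof -
    have "r * 2 ^ d = 2 powr (d - \<tau> * p)"
      by (simp add: r_def t_def powr_powr powr_realpow[symmetric] powr_add[symmetric])
    also have "\<dots> < 2 powr 0"
      using p by (intro powr_less_mono) (auto simp: \<tau>_def field_simps)
    finally show ?thesis
      by simp
  qed
  have M: "0 \<le> M"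
    using V[of 0 0] by linarith
  define y where "y j k = t ^ j * V j k" for j k
  have y0: "0 \<le> y j k" for j k
    using t V by (simp add: y_def)
  have yp: "y j k powr p = r ^ j * V j k powr p" for j k
  proof -
    have "(t ^ j) powr p = r ^ j"
      using t by (simp add: r_def powr_realpow[symmetric] powr_powr mult.commute)
    then show ?thesis
      using t V(1)[of j k] by (simp add: y_def powr_mult)
  qed
  have ysum: "summable (\<lambda>j. y j k powr p)" for k
  proof (rule summable_comparison_test')
    show "summable (\<lambda>j. r ^ j * M powr p)"
      using r by (intro summable_mult2 summable_geometric) simp
    show "norm (y j k powr p) \<le> r ^ j * M powr p" for j
      using r V[of j k] p unfolding yp by (simp add: mult_left_mono powr_mono2)
  qed
  have Xle: "X k powr p \<le> (C / (1 - s)) powr p * (\<Sum>j. y j k powr p)" for k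
  proof (rule geometric_series_le_lp[OF s _ y0 ysum X(1) _ C])
    have "s ^ j * y j k = (1/2) ^ j * V j k" for j
      by (simp add: y_def st[symmetric] power_mult_distrib mult.assoc)
    then show "X k \<le> C * (\<Sum>j. s ^ j * y j k)"
      using X(2)[of k] by simp
  qed (use p in simp)
  have layer: "(\<Sum>k<K. y j k powr p) \<le> M powr (p - 2) * A * (r * 2 ^ d) ^ j" for j K
  proof -
    have "V j k powr p \<le> M powr (p - 2) * (V j k)\<^sup>2" for k
    proof (cases "V j k = 0")
      case False
      then have pos: "0 < V j k"
        using V(1)[of j k] by simp
      then have "V j k powr p = V j k powr (p - 2) * V j k powr 2"
        by (simp only: powr_add[symmetric]) simp
      also have "V j k powr 2 = (V j k)\<^sup>2"
        using pos by simp
      also have "V j k powr (p - 2) * (V j k)\<^sup>2 \<le> M powr (p - 2) * (V j k)\<^sup>2"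
        using V[of j k] p by (intro mult_right_mono powr_mono2) auto
      finally show ?thesis .
    qed simp
    then have "(\<Sum>k<K. V j k powr p) \<le> M powr (p - 2) * (\<Sum>k<K. (V j k)\<^sup>2)"
      unfolding sum_distrib_left by (intro sum_mono)
    also have "\<dots> \<le> M powr (p - 2) * (A * (2 ^ d) ^ j)"
      by (intro mult_left_mono ell2) simp
    finally have "r ^ j * (\<Sum>k<K. V j k powr p) \<le> r ^ j * (M powr (p - 2) * (A * (2 ^ d) ^ j))"
      using r by (intro mult_left_mono) auto
    then show ?thesis
      by (simp add: yp sum_distrib_left power_mult_distrib mult_ac)
  qed
  have geo: "summable (\<lambda>j. M powr (p - 2) * A * (r * 2 ^ d) ^ j)"
    using r rd by (intro summable_mult summable_geometric) simp
  show ?thesis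
  proof (rule summableI_nonneg_bounded)
    fix K
    have "(\<Sum>k<K. X k powr p) \<le> (C / (1 - s)) powr p * (\<Sum>k<K. \<Sum>j. y j k powr p)"
      unfolding sum_distrib_left by (intro sum_mono Xle)
    also have "(\<Sum>k<K. \<Sum>j. y j k powr p) = (\<Sum>j. \<Sum>k<K. y j k powr p)"
      by (rule suminf_sum[symmetric]) (rule ysum)
    also have "\<dots> \<le> (\<Sum>j. M powr (p - 2) * A * (r * 2 ^ d) ^ j)"
      by (intro suminf_le layer geo summable_sum ysum)
    finally show "(\<Sum>k<K. X k powr p) \<le> (C / (1 - s)) powr p * (\<Sum>j. M powr (p - 2) * A * (r * 2 ^ d) ^ j)"
      by (simp add: mult_left_mono)
  qed simp
qed

text \<open>In dimension one the exponent \<open>2\<close> is admissible since it exceeds the dimension; from dimension two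
  on, \<open>d < p\<close> is the binding condition.\<close>

theorem bessel_KR_summable:
  fixes u :: "nat \<Rightarrow> 'a::euclidean_space \<Rightarrow> real"
  assumes "bessel_sequence u" and p: "2 \<le> p" "real DIM('a) < p"
  shows "summable (\<lambda>k. KR_norm (u k) powr p)"
proof -
  have u: "u k \<in> L2_0" for k
    using assms(1) by (simp add: bessel_sequence_def)
  then have u2: "u k \<in> L2_cube" and zero: "(LINT x|lebesgue_on unit_cube. u k x) = 0" for k
    by (auto simp: L2_0_def)
  note int = L2_cube_integrable(1)[OF u2]
  obtain B where B: "\<And>f K. f \<in> L2_0 \<Longrightarrow> (\<Sum>k<K. (L2_inner f (u k))\<^sup>2) \<le> B\<^sup>2 * L2_inner f f"
      "\<And>k. L2_inner (u k) (u k) \<le> B\<^sup>2"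
    using bessel_sequence_bounds[OF assms(1)] by blast
  show ?thesis
  proof (rule summable_powr_of_scales[where V="\<lambda>j k. dyadic_mass (Suc j) (u k)"])
    show "dyadic_mass (Suc j) (u k) \<le> 1 + B\<^sup>2" for j k
      using dyadic_mass_le_L1[OF int, of "Suc j" k] L2_cube_integrable(2)[OF u2, of k] B(2)[of k]
      by linarith
    show "(\<Sum>k<K. (dyadic_mass (Suc j) (u k))\<^sup>2) \<le> (B\<^sup>2 * 2 ^ DIM('a)) * (2 ^ DIM('a)) ^ j" for j K
      using bessel_dyadic_mass[where K=K and j="Suc j", OF u B(1)] by (simp add: mult.assoc)
  qed (use p KR_norm_nonneg[OF int zero] KR_norm_le_dyadic[OF int zero] dyadic_mass_nonneg in auto)
qed

section \<open>Product integrals and the sine system\<close>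

text \<open>Fubini: Lebesgue measure is the product of its one-dimensional copies, and the indicator of the
  cube is itself a product over the coordinates.\<close>

lemma integral_cube_prod_Basis:
  fixes g :: "'a::euclidean_space \<Rightarrow> real \<Rightarrow> real"
  assumes cont: "\<And>b. continuous_on UNIV (g b)"
  shows "(LINT x|lebesgue_on (unit_cube :: 'a set). (\<Prod>b\<in>Basis. g b (x \<bullet> b))) =
    (\<Prod>b\<in>(Basis :: 'a set). (LINT t|lebesgue_on (unit_cube :: real set). g b t))"
proof -
  define h where "h b t = indicator (unit_cube :: real set) t * g b t" for b t
  have g [measurable]: "g b \<in> borel_measurable borel" for b
    using cont by (simp add: borel_measurable_continuous_onI)
  have I [measurable]: "(unit_cube :: real set) \<in> sets borel" "(unit_cube :: 'a set) \<in> sets borel"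
    by (simp_all add: unit_cube_def)
  have h [measurable]: "h b \<in> borel_measurable borel" for b
    unfolding h_def by measurable
  interpret product_sigma_finite "\<lambda>_ :: 'a. lborel :: real measure"
    by standard
  have one: "(LINT t|lebesgue_on (unit_cube :: real set). g b t) = (LINT t|lborel. h b t)" for b
  proof -
    have "(LINT t|lebesgue_on (unit_cube :: real set). g b t) = (LINT t|lebesgue. h b t)"
      by (subst integral_restrict_space) (simp_all add: h_def[abs_def])
    also have "\<dots> = (LINT t|lborel. h b t)"
      by (rule integral_completion) simp
    finally show ?thesis .
  qed
  have h_int: "integrable lborel (h b)" for b
  proof -
    have "bounded (g b ` {0..1})"
      by (intro compact_imp_bounded compact_continuous_image continuous_on_subset[OF cont]) auto
    then obtain M where M: "\<And>t. t \<in> {0..1} \<Longrightarrow> \<bar>g b t\<bar> \<le> M"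
      unfolding bounded_iff by (metis imageI real_norm_def)
    have "integrable (lebesgue_on unit_cube) (g b)"
      by (rule integrable_cube_bounded[where B=M])
         (use M in \<open>auto simp: unit_cube_real intro: borel_measurable_cube[OF g, unfolded unit_cube_real]\<close>)
    then have "integrable lebesgue (\<lambda>t. indicator unit_cube t *\<^sub>R g b t)"
      by (subst (asm) integrable_restrict_space) auto
    then have "integrable lebesgue (h b)"
      by (simp add: h_def[abs_def])
    then show ?thesis
      by (subst (asm) integrable_completion) auto
  qed
  have split: "indicator (unit_cube :: 'a set) x * (\<Prod>b\<in>Basis. g b (x \<bullet> b)) = (\<Prod>b\<in>Basis. h b (x \<bullet> b))" for x
  proof (cases "x \<in> (unit_cube :: 'a set)")
    case True
    then have "x \<bullet> b \<in> (unit_cube :: real set)" if "b \<in> Basis" for b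
      using that by (simp add: unit_cube_real unit_cube_def[where 'a='a] mem_box)
    then show ?thesis
      using True by (simp add: h_def)
  next
    case False
    then obtain b :: 'a where b: "b \<in> Basis" "x \<bullet> b \<notin> (unit_cube :: real set)"
      unfolding unit_cube_real unit_cube_def[where 'a='a] mem_box by auto
    then have "(\<Prod>b\<in>Basis. h b (x \<bullet> b)) = 0"
      by (intro prod_zero bexI[OF _ b(1)]) (simp_all add: h_def)
    then show ?thesis
      using False by simp
  qed
  have "(LINT x|lebesgue_on (unit_cube :: 'a set). (\<Prod>b\<in>Basis. g b (x \<bullet> b)))
      = (LINT x|lebesgue. (\<Prod>b\<in>Basis. h b (x \<bullet> b :: real)))"
    by (subst integral_restrict_space) (simp_all add: split)
  also have "\<dots> = (LINT x|lborel. (\<Prod>b\<in>(Basis :: 'a set). h b (x \<bullet> b)))"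
    by (rule integral_completion) simp
  also have "\<dots> = (LINT f|(\<Pi>\<^sub>M b\<in>(Basis :: 'a set). lborel). (\<Prod>b\<in>(Basis :: 'a set). h b (f b)))"
    unfolding lborel_eq[where 'a='a] by (subst integral_distr) (auto intro!: prod.cong)
  also have "\<dots> = (\<Prod>b\<in>(Basis :: 'a set). (LINT t|lborel. h b t))"
    by (rule product_integral_prod) (auto intro: h_int)
  finally show ?thesis
    by (simp add: one)
qed

lemma integral_cube_prod:
  fixes g :: "'n::finite \<Rightarrow> real \<Rightarrow> real"
  assumes "\<And>i. continuous_on UNIV (g i)"
  shows "(LINT x|lebesgue_on (unit_cube :: (real^'n) set). (\<Prod>i\<in>UNIV. g i (x $ i))) =
    (\<Prod>i\<in>UNIV. (LINT t|lebesgue_on (unit_cube :: real set). g i t))"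
proof -
  have Basis: "(Basis :: (real^'n) set) = range (\<lambda>i. axis i 1)"
    by (auto simp: Basis_vec_def)
  have inj: "inj (\<lambda>i :: 'n. axis i (1::real))"
    by (simp add: inj_on_def axis_eq_axis)
  show ?thesis
    using integral_cube_prod_Basis[where g="\<lambda>b :: real^'n. g (axis_index b)", OF assms]
    by (simp add: Basis prod.reindex[OF inj] cart_eq_inner_axis[symmetric] inner_axis)
qed

lemma integral_cos_pi:
  fixes k :: int
  shows "((\<lambda>t. cos (pi * k * t)) has_integral (if k = 0 then 1 else 0)) {0..1}"
proof (cases "k = 0")
  case True
  then show ?thesis
    using has_integral_const_real[of "1::real" 0 1] by simp
next
  case False
  have "((\<lambda>t. cos (pi * k * t)) has_integral (sin (pi * k * 1) / (pi * k) - sin (pi * k * 0) / (pi * k))) {0..1}"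
    by (rule fundamental_theorem_of_calculus)
       (use False in \<open>auto intro!: derivative_eq_intros simp: has_real_derivative_iff_has_vector_derivative[symmetric]\<close>)
  with False show ?thesis
    by (simp add: sin_int_times_real mult.commute)
qed

lemma integral_cube_real:
  fixes f :: "real \<Rightarrow> real"
  assumes "continuous_on UNIV f" "(f has_integral I) {0..1}"
  shows "(LINT t|lebesgue_on (unit_cube :: real set). f t) = I"
proof -
  have "bounded (f ` {0..1})"
    by (intro compact_imp_bounded compact_continuous_image continuous_on_subset[OF assms(1)]) auto
  then obtain M where M: "\<And>t. t \<in> {0..1} \<Longrightarrow> \<bar>f t\<bar> \<le> M"
    unfolding bounded_iff by (metis imageI real_norm_def)
  have "integrable (lebesgue_on unit_cube) f"
    by (rule integrable_cube_bounded[where B=M])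
       (use M in \<open>auto simp: unit_cube_real
         intro: borel_measurable_cube[OF borel_measurable_continuous_onI[OF assms(1)], unfolded unit_cube_real]\<close>)
  then have "(f has_integral (LINT t|lebesgue_on unit_cube. f t)) unit_cube"
    by (rule has_integral_integral_lebesgue_on) simp
  moreover have "(f has_integral I) (unit_cube :: real set)"
    using assms(2) has_integral_open_interval[of f I 0 "1::real"] by (simp add: unit_cube_real)
  ultimately show ?thesis
    by (rule has_integral_unique)
qed

lemma integral_sin_sin:
  fixes m n :: nat
  assumes "0 < m" "0 < n"
  shows "(LINT t|lebesgue_on (unit_cube :: real set). sin (pi * m * t) * sin (pi * n * t))
    = (if m = n then 1/2 else 0)"
proof (rule integral_cube_real)
  have eq: "sin (pi * m * t) * sin (pi * n * t)
     = (cos (pi * (int m - int n) * t) - cos (pi * (int m + int n) * t)) / 2" for t :: real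
    by (simp add: sin_times_sin algebra_simps)
  show "((\<lambda>t. sin (pi * m * t) * sin (pi * n * t)) has_integral (if m = n then 1/2 else 0)) {0..1}"
    using has_integral_divide[OF has_integral_diff[OF integral_cos_pi[of "int m - int n"] integral_cos_pi[of "int m + int n"]], of 2] assms
    unfolding eq by (auto split: if_splits)
qed (intro continuous_intros)

text \<open>The integral over a whole number of periods vanishes: this is why only even frequencies are used.\<close>

lemma integral_sin_even:
  fixes n :: nat
  assumes "0 < n" "even n"
  shows "(LINT t|lebesgue_on (unit_cube :: real set). sin (pi * n * t)) = 0"
proof (rule integral_cube_real)
  have "((\<lambda>t. sin (pi * n * t)) has_integral (- cos (pi * n * 1) / (pi * n) - - cos (pi * n * 0) / (pi * n))) {0..1}"
    by (rule fundamental_theorem_of_calculus)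
       (use assms in \<open>auto intro!: derivative_eq_intros simp: has_real_derivative_iff_has_vector_derivative[symmetric]\<close>)
  moreover have "cos (pi * n) = 1"
    using assms(2) cos_npi2[of n] by simp
  ultimately show "((\<lambda>t. sin (pi * n * t)) has_integral 0) {0..1}"
    by simp
qed (intro continuous_intros)

lemma sine_product_measurable [measurable]:
  "sine_product (n :: nat^'n) \<in> borel_measurable (lebesgue_on unit_cube)"
  unfolding sine_product_def[abs_def]
  by (intro borel_measurable_cube borel_measurable_continuous_onI continuous_intros)

lemma sine_product_L2: "sine_product (n :: nat^'n) \<in> L2_cube"
proof (rule L2_cubeI_bounded)
  show "\<bar>sine_product n x\<bar> \<le> 2 powr (real CARD('n) / 2) * 1" for x
    unfolding sine_product_def abs_mult abs_prod
    by (intro mult_mono prod_le_1) (auto simp: prod_nonneg)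
qed simp

lemma sine_product_mean:
  fixes n :: "nat^'n"
  assumes "n \<in> even_indices"
  shows "(LINT x|lebesgue_on unit_cube. sine_product n x) = 0"
proof -
  have "(LINT x|lebesgue_on unit_cube. sine_product n x) = 2 powr (real CARD('n) / 2) *
    (\<Prod>i\<in>UNIV. (LINT t|lebesgue_on (unit_cube :: real set). sin (pi * (n $ i) * t)))"
    unfolding sine_product_def
    by (subst integral_cube_prod[symmetric]) (auto intro!: continuous_intros)
  then show ?thesis
    using assms by (simp add: even_indices_def integral_sin_even)
qed

lemma sine_product_orthonormal:
  "orthonormal_family even_indices (sine_product :: nat^'n \<Rightarrow> real^'n \<Rightarrow> real)"
  unfolding orthonormal_family_def
proof (intro conjI ballI sine_product_L2)
  fix m n :: "nat^'n" assume mn: "m \<in> even_indices" "n \<in> even_indices"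
  have two: "(2::real) powr (real CARD('n) / 2) * 2 powr (real CARD('n) / 2) = 2 ^ CARD('n)"
    by (simp add: powr_add[symmetric] powr_realpow)
  have "L2_inner (sine_product m) (sine_product n) = (LINT x|lebesgue_on (unit_cube :: (real^'n) set).
      2 ^ CARD('n) * (\<Prod>i\<in>UNIV. sin (pi * (m $ i) * x $ i) * sin (pi * (n $ i) * x $ i)))"
    unfolding L2_inner_def two[symmetric] by (simp add: sine_product_def prod.distrib mult_ac)
  also have "\<dots> = 2 ^ CARD('n) *
      (\<Prod>i\<in>UNIV. (LINT t|lebesgue_on (unit_cube :: real set). sin (pi * (m $ i) * t) * sin (pi * (n $ i) * t)))"
    by (subst integral_cube_prod[symmetric]) (auto intro!: continuous_intros)
  also have "\<dots> = 2 ^ CARD('n) * (\<Prod>i\<in>UNIV. if m $ i = n $ i then 1/2 else 0)"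
    using mn by (simp add: even_indices_def integral_sin_sin)
  also have "\<dots> = (if m = n then 1 else 0)"
  proof (cases "m = n")
    case False
    then obtain i where "m $ i \<noteq> n $ i"
      by (auto simp: vec_eq_iff)
    then have "(\<Prod>i\<in>UNIV. if m $ i = n $ i then 1/2 else 0 :: real) = 0"
      by (intro prod_zero) auto
    then show ?thesis
      using False by simp
  qed (simp add: power_one_over)
  finally show "L2_inner (sine_product m) (sine_product n) = (if m = n then 1 else 0)" .
qed

section \<open>Lower bound for the sine system\<close>

lemma abs_sin_diff_le_abs_diff: "\<bar>sin x - sin y\<bar> \<le> \<bar>x - y\<bar>" for x y :: real
proof -
  have "\<bar>sin x - sin y\<bar> = 2 * (\<bar>sin ((x - y) / 2)\<bar> * \<bar>cos ((x + y) / 2)\<bar>)"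
    by (simp add: sin_diff_sin abs_mult)
  also have "\<dots> \<le> 2 * (\<bar>(x - y) / 2\<bar> * 1)"
    by (intro mult_left_mono mult_mono abs_sin_x_le_abs_x abs_cos_le_one) auto
  finally show ?thesis
    by simp
qed

text \<open>All factors are bounded by \<open>1\<close>, so the variation of the product is at most the sum of the
  variations of the factors.\<close>

lemma sine_product_lipschitz:
  fixes n :: "nat^'n"
  assumes "\<And>i. n $ i \<le> N"
  shows "(2 powr (real CARD('n) / 2) * (pi * real CARD('n) * real N))-lipschitz_on unit_cube (sine_product n)"
proof (rule lipschitz_onI)
  fix x y :: "real^'n"
  have "\<bar>(\<Prod>i\<in>UNIV. sin (pi * real (n $ i) * x $ i)) - (\<Prod>i\<in>UNIV. sin (pi * real (n $ i) * y $ i))\<bar>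
      \<le> (\<Sum>i\<in>UNIV. \<bar>sin (pi * real (n $ i) * x $ i) - sin (pi * real (n $ i) * y $ i)\<bar>)"
    using norm_prod_diff[of UNIV "\<lambda>i. sin (pi * real (n $ i) * x $ i)" "\<lambda>i. sin (pi * real (n $ i) * y $ i)"]
    by simp
  also have "\<dots> \<le> (\<Sum>i\<in>(UNIV :: 'n set). pi * real N * dist x y)"
  proof (rule sum_mono)
    fix i :: 'n
    have "\<bar>sin (pi * real (n $ i) * x $ i) - sin (pi * real (n $ i) * y $ i)\<bar>
        \<le> \<bar>pi * real (n $ i) * x $ i - pi * real (n $ i) * y $ i\<bar>"
      by (rule abs_sin_diff_le_abs_diff)
    also have "\<dots> = pi * real (n $ i) * dist (x $ i) (y $ i)"
      by (simp add: dist_real_def abs_mult right_diff_distrib[symmetric])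
    also have "\<dots> \<le> pi * real N * dist x y"
      using assms[of i] by (intro mult_mono dist_vec_nth_le) auto
    finally show "\<bar>sin (pi * real (n $ i) * x $ i) - sin (pi * real (n $ i) * y $ i)\<bar> \<le> pi * real N * dist x y" .
  qed
  finally show "dist (sine_product n x) (sine_product n y)
      \<le> 2 powr (real CARD('n) / 2) * (pi * real CARD('n) * real N) * dist x y"
    by (simp add: sine_product_def dist_real_def right_diff_distrib[symmetric] abs_mult mult_ac)
qed simp

text \<open>The function itself, divided by its Lipschitz constant, is the test function; pairing it with the
  function gives the squared norm \<open>1\<close> over that constant.\<close>

lemma KR_norm_sine_product_ge:
  fixes n :: "nat^'n"
  assumes n: "n \<in> even_indices" "\<And>i. n $ i \<le> N"
  shows "1 / (2 powr (real CARD('n) / 2) * (pi * real CARD('n) * real N)) \<le> KR_norm (sine_product n)"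
proof -
  define L where "L = 2 powr (real CARD('n) / 2) * (pi * real CARD('n) * real N)"
  have "0 < N"
    using n less_le_trans unfolding even_indices_def by blast
  then have L: "0 < L"
    by (simp add: L_def)
  have "L-lipschitz_on unit_cube (sine_product n)"
    unfolding L_def by (rule sine_product_lipschitz[OF n(2)])
  then have "(\<bar>1 / L\<bar> * L)-lipschitz_on unit_cube (\<lambda>x. (1 / L) * sine_product n x)"
    by (rule lipschitz_on_cmult_real)
  then have "1-lipschitz_on unit_cube (\<lambda>x. (1 / L) * sine_product n x)"
    using L by simp
  then have "(LINT x|lebesgue_on unit_cube. sine_product n x * ((1 / L) * sine_product n x)) \<le> KR_norm (sine_product n)"
    by (intro integral_le_KR_norm L2_cube_integrable(1) sine_product_L2 sine_product_mean n(1))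
  moreover have "(LINT x|lebesgue_on unit_cube. sine_product n x * ((1 / L) * sine_product n x))
      = 1 / L * L2_inner (sine_product n) (sine_product n)"
    unfolding L2_inner_def by (simp add: mult.left_commute[of _ "1 / L"] del: times_divide_eq_left)
  moreover have "L2_inner (sine_product n) (sine_product n) = 1"
    using sine_product_orthonormal n(1) by (auto simp: orthonormal_family_def)
  ultimately show ?thesis
    using L unfolding L_def[symmetric] by simp
qed

text \<open>The cardinality of a block is of order \<open>2^(m * d)\<close>, and the sine functions that it indexes have
  norms of order at least \<open>2^-m\<close>. The \<open>d\<close>-th powers over one block therefore sum to at least a constant not depending on \<open>m\<close>.\<close>

definition dyadic_block :: "nat \<Rightarrow> (nat^'n) set" where
  "dyadic_block m = {n. \<forall>i. even (n $ i) \<and> 2 ^ m < n $ i \<and> n $ i \<le> 2 ^ Suc m}"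

lemma dyadic_block_subset: "dyadic_block m \<subseteq> even_indices"
  by (auto simp: dyadic_block_def even_indices_def intro: le_less_trans)

lemma dyadic_block_disjoint:
  assumes "m \<noteq> m'"
  shows "dyadic_block m \<inter> (dyadic_block m' :: (nat^'n) set) = {}"
proof -
  have aux: "\<not> (n \<in> dyadic_block m \<and> n \<in> dyadic_block m')" if "m < m'" for m m' and n :: "nat^'n"
  proof
    assume "n \<in> dyadic_block m \<and> n \<in> dyadic_block m'"
    then have "2 ^ m' < (2::nat) ^ Suc m"
      by (auto simp: dyadic_block_def) (meson less_le_trans power_Suc)
    with that show False
      by (simp del: power_Suc)
  qed
  show ?thesis
    using aux[of m m'] aux[of m' m] assms by (cases "m < m'") auto
qed

lemma dyadic_block_card:
  "finite (dyadic_block (Suc m) :: (nat^'n) set)"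
  "card (dyadic_block (Suc m) :: (nat^'n) set) = (2 ^ m) ^ CARD('n)"
proof -
  define F where "F = (UNIV :: 'n set) \<rightarrow>\<^sub>E {2 ^ m<..2 ^ Suc m :: nat}"
  have F: "finite F" "card F = (2 ^ m) ^ CARD('n)"
    by (auto simp: F_def finite_PiE card_PiE)
  have "bij_betw (\<lambda>\<phi>. \<chi> i. 2 * \<phi> i) F (dyadic_block (Suc m) :: (nat^'n) set)"
  proof (rule bij_betwI[where g="\<lambda>n i. n $ i div 2"])
    show "(\<lambda>\<phi>. \<chi> i. 2 * \<phi> i) \<in> F \<rightarrow> (dyadic_block (Suc m) :: (nat^'n) set)"
      by (auto simp: F_def dyadic_block_def PiE_iff)
    show "(\<lambda>n i. n $ i div 2) \<in> (dyadic_block (Suc m) :: (nat^'n) set) \<rightarrow> F"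
    proof (intro Pi_I)
      fix n :: "nat^'n" assume n: "n \<in> dyadic_block (Suc m)"
      have "2 ^ m < n $ i div 2 \<and> n $ i div 2 \<le> 2 ^ Suc m" for i
      proof -
        have "even (n $ i)" "2 ^ Suc m < n $ i" "n $ i \<le> 2 ^ Suc (Suc m)"
          using n by (auto simp: dyadic_block_def)
        then show ?thesis
          by (auto elim!: evenE)
      qed
      then show "(\<lambda>i. n $ i div 2) \<in> F"
        by (simp add: F_def PiE_iff)
    qed
  qed (auto simp: dyadic_block_def vec_eq_iff)
  then show "finite (dyadic_block (Suc m) :: (nat^'n) set)"
    "card (dyadic_block (Suc m) :: (nat^'n) set) = (2 ^ m) ^ CARD('n)"
    using F bij_betw_finite bij_betw_same_card by metis+
qed

lemma sine_product_block_sum: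
  defines "\<delta> \<equiv> (1 / (2 powr (real CARD('n::finite) / 2) * (pi * real CARD('n) * 4))) ^ CARD('n)"
  shows "ennreal \<delta> \<le> (\<Sum>n\<in>dyadic_block (Suc m). ennreal (KR_norm (sine_product (n :: nat^'n)) ^ CARD('n)))"
proof -
  define K where "K = 2 powr (real CARD('n) / 2) * (pi * real CARD('n))"
  have K: "0 < K"
    by (simp add: K_def)
  have step: "(1 / (K * 2 ^ Suc (Suc m))) ^ CARD('n) \<le> KR_norm (sine_product n) ^ CARD('n)"
    if n: "n \<in> dyadic_block (Suc m)" for n :: "nat^'n"
  proof (rule power_mono)
    have "n $ i \<le> 2 ^ Suc (Suc m)" for i
      using n by (simp add: dyadic_block_def)
    from KR_norm_sine_product_ge[OF _ this] n dyadic_block_subset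
    show "1 / (K * 2 ^ Suc (Suc m)) \<le> KR_norm (sine_product n)"
      by (auto simp: K_def mult.assoc)
  qed (use K in simp)
  have "\<delta> = (\<Sum>n\<in>(dyadic_block (Suc m) :: (nat^'n) set). (1 / (K * 2 ^ Suc (Suc m))) ^ CARD('n))"
  proof -
    have "(2 ^ m) ^ CARD('n) * (1 / (K * 2 ^ Suc (Suc m))) ^ CARD('n) = (1 / (K * 4)) ^ CARD('n)"
      by (simp add: power_mult_distrib[symmetric])
    then show ?thesis
      by (simp add: \<delta>_def K_def dyadic_block_card mult.assoc)
  qed
  then have "ennreal \<delta> = (\<Sum>n\<in>(dyadic_block (Suc m) :: (nat^'n) set). ennreal ((1 / (K * 2 ^ Suc (Suc m))) ^ CARD('n)))"
    using K by (subst sum_ennreal) auto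
  also have "\<dots> \<le> (\<Sum>n\<in>dyadic_block (Suc m). ennreal (KR_norm (sine_product (n :: nat^'n)) ^ CARD('n)))"
    by (intro sum_mono ennreal_leI step)
  finally show ?thesis .
qed

text \<open>The blocks are pairwise disjoint and infinite in number, each contributing at least the same
  positive amount.\<close>

lemma sine_product_KR_sum_infinite:
  "(\<Sum>\<^sub>\<infinity>n\<in>even_indices. ennreal (KR_norm (sine_product (n :: nat^'n)) ^ CARD('n))) = \<infinity>"
proof -
  define \<delta> where "\<delta> = (1 / (2 powr (real CARD('n) / 2) * (pi * real CARD('n) * 4))) ^ CARD('n)"
  define a where "a n = ennreal (KR_norm (sine_product n) ^ CARD('n))" for n :: "nat^'n"
  have \<delta>: "0 < \<delta>"
    by (simp add: \<delta>_def)
  have le: "of_nat M * ennreal \<delta> \<le> infsum a even_indices" for M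
  proof -
    define D where "D = (\<Union>m<M. dyadic_block (Suc m) :: (nat^'n) set)"
    have "of_nat M * ennreal \<delta> \<le> (\<Sum>m<M. sum a (dyadic_block (Suc m)))"
      using sum_mono[OF sine_product_block_sum[where 'n='n], of "{..<M}"]
      by (simp add: a_def \<delta>_def)
    also have "\<dots> = sum a D"
      unfolding D_def by (subst sum.UNION_disjoint) (auto simp: dyadic_block_card dyadic_block_disjoint)
    also have "\<dots> \<le> infsum a even_indices"
    proof -
      have "finite D" "D \<subseteq> even_indices"
        using dyadic_block_subset by (auto simp: D_def dyadic_block_card)
      then show ?thesis
        by (subst nonneg_infsum_complete) (auto intro!: SUP_upper)
    qed
    finally show ?thesis .
  qed
  have "infsum a even_indices = \<infinity>"
  proof (rule ccontr)
    assume "infsum a even_indices \<noteq> \<infinity>"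
    then obtain r where r: "0 \<le> r" "infsum a even_indices = ennreal r"
      by (cases "infsum a even_indices") auto
    obtain M :: nat where "r / \<delta> < M"
      using reals_Archimedean2 by blast
    then have "r < M * \<delta>"
      using \<delta> by (simp add: field_simps)
    moreover have "ennreal (M * \<delta>) \<le> ennreal r"
      using le[of M] \<delta> r by (simp add: ennreal_mult ennreal_of_nat_eq_real_of_nat)
    ultimately show False
      using r by (simp add: ennreal_le_iff)
  qed
  then show ?thesis
    by (simp add: a_def[abs_def])
qed

section \<open>The summability exponents of the Kantorovich--Rubinstein norm\<close>

theorem theorem3p1:
  shows "(\<forall>u :: nat \<Rightarrow> real \<Rightarrow> real. bessel_sequence u \<longrightarrow> summable (\<lambda>k. (KR_norm (u k))\<^sup>2)) \<and>
    (CARD('n::finite) \<ge> 2 \<longrightarrow>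
      (\<forall>u :: nat \<Rightarrow> real^'n \<Rightarrow> real. bessel_sequence u \<longrightarrow>
        (\<forall>\<epsilon>>0. summable (\<lambda>k. KR_norm (u k) powr (real CARD('n) + \<epsilon>))))) \<and>
    (orthonormal_family even_indices (sine_product :: nat^'n \<Rightarrow> real^'n \<Rightarrow> real) \<and>
      (\<Sum>\<^sub>\<infinity>n\<in>even_indices. ennreal (KR_norm (sine_product (n :: nat^'n)) ^ CARD('n))) = \<infinity>)"
proof (intro conjI impI allI)
  fix u :: "nat \<Rightarrow> real \<Rightarrow> real"
  assume u: "bessel_sequence u"
  have "0 \<le> KR_norm (u k)" for k
  proof -
    have "u k \<in> L2_0"
      using u by (simp add: bessel_sequence_def)
    then show ?thesis
      by (intro KR_norm_nonneg L2_cube_integrable(1)) (auto simp: L2_0_def)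
  qed
  with bessel_KR_summable[OF u, of 2] show "summable (\<lambda>k. (KR_norm (u k))\<^sup>2)"
    by simp
next
  fix u :: "nat \<Rightarrow> real^'n \<Rightarrow> real" and \<epsilon> :: real
  assume "2 \<le> CARD('n)" "bessel_sequence u" "0 < \<epsilon>"
  then show "summable (\<lambda>k. KR_norm (u k) powr (real CARD('n) + \<epsilon>))"
    by (intro bessel_KR_summable) auto
qed (rule sine_product_orthonormal sine_product_KR_sum_infinite)+

end
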